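(* Let $n\ge2$, $A\in\mathbb{R}^{m\times n}$, $b\in\mathbb{R}^m$, and consider $\min\frac12\|Ax-b\|^2$ subject to $x\in\mathcal C=\{x\in\mathbb{R}^n:\|x\|=1\}$. Let $x^*\in\mathcal C$ be a stationary point, i.e. $A^\top(Ax^*-b)=\gamma x^*$ with $\gamma=(x^* )^\top A^\top(Ax^*-b)$. Let $U_{x^*}\in\mathbb{R}^{n\times(n-1)}$ have orthonormal columns with $U_{x^*}U_{x^*}^\top=I_n-x^*(x^* )^\top$, and let $\lambda_1$ and $\lambda_{n-1}$ be the largest and smallest eigenvalues of $(AU_{x^*})^\top AU_{x^*}$. If $\eta>0$, $$\gamma<\lambda_{n-1}\qquad\text{and}\qquad\eta(\gamma+\lambda_1)<2,$$ then projected gradient descent with step size $\eta$ converges locally to $x^*$ at the asymptotic linear rate $$\rho=\frac{1}{1-\eta\gamma}\max\{|1-\eta\lambda_1|,\ |1-\eta\lambda_{n-1}|\}<1,$$ with region of linear convergence $$\|x^{(0)}-x^*\|<\frac{1-\rho}{2(t^2+t)},\qquad t=\frac{\|I_n-\eta A^\top A\|_2}{1-\eta\gamma}.$$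
   Context: $\|\cdot\|$ is the Euclidean norm, $\|\cdot\|_2$ the spectral norm. A quotient with zero denominator is read as $+\infty$ in the region of convergence. The projection onto $\mathcal C$ is $P_{\mathcal C}(x)=x/\|x\|$ for $x\ne0$ and $P_{\mathcal C}(0)=e_1$ (the first standard basis vector). PGD: starting from $x^{(0)}\in\mathcal C$, $x^{(k+1)}=P_{\mathcal C}\bigl(x^{(k)}-\eta A^\top(Ax^{(k)}-b)\bigr)$ for $k\ge0$. Local convergence to $x^*$ at asymptotic linear rate $\rho$ with a given region means: $x^*=P_{\mathcal C}(x^*-\eta A^\top(Ax^*-b))$, and for every $x^{(0)}\in\mathcal C$ in the region the PGD iterates satisfy (when $\rho>0$): for any $0<\epsilon<1$, $\|x^{(k)}-x^*\|\le\epsilon\|x^{(0)}-x^*\|$ for all integers $k\ge\frac{\log(1/\epsilon)}{\log(1/\rho)}+c_3(\rho,\tau)$, where $\tau=\frac{2(t^2+t)\|x^{(0)}-x^*\|}{1-\rho}$ and, for $0<\rho<1$, $0\le\tau<1$, $$c_3(\rho,\tau)=\frac{E_1\bigl(\log\frac{1}{\rho+\tau(1-\rho)}\bigr)-E_1\bigl(\log\frac1\rho\bigr)}{\rho\log(1/\rho)}+\frac{1}{2\rho}\log\Bigl(\frac{\log(1/\rho)}{\log\bigl(1/(\rho+\tau(1-\rho))\bigr)}\Bigr)+1,\qquad E_1(t)=\int_t^\infty\frac{e^{-z}}{z}\,dz.$$ *)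

theory Defs
  imports "HOL-Analysis.Analysis"
begin

definition unit_sphere :: "(real ^ 'n) set" where
  "unit_sphere = {x. norm x = 1}"

definition first_basis_vector :: "real ^ 'n::{finite,linorder}" where
  "first_basis_vector = axis (Min UNIV) 1"

definition sphere_proj :: "real ^ 'n::{finite,linorder} \<Rightarrow> real ^ 'n::{finite,linorder}" where
  "sphere_proj x = (if x = 0 then first_basis_vector else x /\<^sub>R norm x)"

definition ls_gradient :: "real ^ 'n ^ 'm \<Rightarrow> real ^ 'm \<Rightarrow> real ^ 'n \<Rightarrow> real ^ 'n" where
  "ls_gradient A b x = transpose A *v (A *v x - b)"

definition pgd_step ::
    "real ^ 'n::{finite,linorder} ^ 'm \<Rightarrow> real ^ 'm \<Rightarrow> real \<Rightarrow> real ^ 'n::{finite,linorder} \<Rightarrow> real ^ 'n::{finite,linorder}" where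
  "pgd_step A b \<eta> x = sphere_proj (x - \<eta> *\<^sub>R ls_gradient A b x)"

definition pgd ::
    "real ^ 'n::{finite,linorder} ^ 'm \<Rightarrow> real ^ 'm \<Rightarrow> real \<Rightarrow> real ^ 'n::{finite,linorder} \<Rightarrow> nat \<Rightarrow> real ^ 'n::{finite,linorder}" where
  "pgd A b \<eta> x0 k = (pgd_step A b \<eta> ^^ k) x0"

definition outer_prod :: "real ^ 'n \<Rightarrow> real ^ 'n \<Rightarrow> real ^ 'n ^ 'n" where
  "outer_prod x y = (\<chi> i j. x $ i * y $ j)"

definition orthonormal_columns :: "real ^ 'k ^ 'n \<Rightarrow> bool" where
  "orthonormal_columns U \<longleftrightarrow>
     (\<forall>i j. column i U \<bullet> column j U = (if i = j then 1 else 0))"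

definition eigenvalues :: "real ^ 'k ^ 'k \<Rightarrow> real set" where
  "eigenvalues M = {l. \<exists>v. v \<noteq> 0 \<and> M *v v = l *\<^sub>R v}"

definition spectral_norm :: "real ^ 'n ^ 'm \<Rightarrow> real" where
  "spectral_norm M = onorm ((*v) M)"

definition exp_integral_E1 :: "real \<Rightarrow> real" where
  "exp_integral_E1 t = integral {t..} (\<lambda>z. exp (- z) / z)"

definition c3 :: "real \<Rightarrow> real \<Rightarrow> real" where
  "c3 \<rho> \<tau> =
     (exp_integral_E1 (ln (1 / (\<rho> + \<tau> * (1 - \<rho>)))) - exp_integral_E1 (ln (1 / \<rho>)))
       / (\<rho> * ln (1 / \<rho>))
     + 1 / (2 * \<rho>) * ln (ln (1 / \<rho>) / ln (1 / (\<rho> + \<tau> * (1 - \<rho>))))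
     + 1"

text \<open>
  The quotient is taken in the extended reals, where a positive number divided
  by \<open>0\<close> is \<open>\<infinity>\<close>: for \<open>t = 0\<close> and \<open>\<rho> < 1\<close> the region is the whole space.
\<close>

definition convergence_region :: "real ^ 'n \<Rightarrow> real \<Rightarrow> real \<Rightarrow> (real ^ 'n) set" where
  "convergence_region xs \<rho> t =
     {x0. ereal (norm (x0 - xs)) < ereal (1 - \<rho>) / ereal (2 * (t\<^sup>2 + t))}"

text \<open>
  For \<open>\<rho> = 0\<close> only the fixed-point equation is claimed: the iteration bound
  involves \<open>ln (1 / \<rho>)\<close> and \<open>1 / \<rho>\<close>.
\<close>

definition locally_converges_at_rate ::
    "real ^ 'n::{finite,linorder} ^ 'm \<Rightarrow> real ^ 'm \<Rightarrow> real \<Rightarrow> real ^ 'n::{finite,linorder} \<Rightarrow> real \<Rightarrow> real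
      \<Rightarrow> (real ^ 'n::{finite,linorder}) set \<Rightarrow> bool" where
  "locally_converges_at_rate A b \<eta> xs \<rho> t R \<longleftrightarrow>
     xs = sphere_proj (xs - \<eta> *\<^sub>R ls_gradient A b xs) \<and>
     (\<forall>x0 \<in> unit_sphere \<inter> R. \<rho> > 0 \<longrightarrow>
        (let \<tau> = 2 * (t\<^sup>2 + t) * norm (x0 - xs) / (1 - \<rho>) in
         \<forall>\<epsilon>. 0 < \<epsilon> \<and> \<epsilon> < 1 \<longrightarrow>
           (\<forall>k::nat. real k \<ge> ln (1 / \<epsilon>) / ln (1 / \<rho>) + c3 \<rho> \<tau> \<longrightarrow>
              norm (pgd A b \<eta> x0 k - xs) \<le> \<epsilon> * norm (x0 - xs))))"

end

theory Submission
  imports Defs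
begin

text \<open>
  One step of projected gradient descent moves the error from \<open>d\<close> to at most
  \<open>\<rho> d + 2 (t\<^sup>2 + t) d\<^sup>2\<close> (lemma \<open>pgd_step_error\<close>), and a scalar sequence with such a bound
  falls below \<open>\<epsilon>\<close> times its start after the stated number of steps
  (lemma \<open>quadratic_recursion_bound\<close>).

  For the first part, stationarity turns the argument of the projection into a positive multiple
  of \<open>xs + w\<close>, where \<open>w\<close> is the image of the error under
  \<open>(I - \<eta> A\<^sup>T A) / (1 - \<eta> \<gamma>)\<close>. To first order the projection keeps the component of \<open>w\<close> tangent
  to the sphere at \<open>xs\<close>. The error itself is tangent up to a second order term, because both
  endpoints lie on the sphere, so what remains is the compression of \<open>I - \<eta> A\<^sup>T A\<close> to the
  tangent space. In the basis \<open>U\<close> this is \<open>I - \<eta> (A U)\<^sup>T (A U)\<close>, whose norm is read off the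
  extreme eigenvalues (lemma \<open>symmetric_gradient_step_norm\<close>). The two hypotheses on \<open>\<gamma>\<close> say
  exactly that this norm is below \<open>1 - \<eta> \<gamma>\<close>.

  For the second part, normalise to \<open>d\<^sub>0 = 1\<close> and write the recursion as \<open>x \<mapsto> x g(x)\<close> with
  \<open>g(x) = \<rho> + c x\<close>. On the logarithmic scale a step has length \<open>f(x) = - ln (g(x))\<close>, so the time needed
  to descend is roughly the integral of \<open>1 / (x f(x))\<close>. The claimed number of steps is an upper bound
  for this integral plus its discretisation error: in \<open>c3\<close> the exponential integrals come from replacing
  \<open>1 / f\<close> by \<open>1 / ln (1 / \<rho>)\<close>, the logarithm of logarithms from the discretisation. Here both are collected in one
  primitive, \<open>step_clock\<close>, which falls by at least \<open>1\<close> at every step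
  (lemma \<open>step_clock_decrease\<close>).
\<close>

section \<open>The exponential integral\<close>

lemma E1_integrable:
  fixes t :: real assumes "t > 0"
  shows "(\<lambda>z. exp (- z) / z) integrable_on {t..}"
proof (rule measurable_bounded_by_integrable_imp_integrable)
  show "(\<lambda>z::real. exp (- z) / z) \<in> borel_measurable (lebesgue_on {t..})"
    by (rule continuous_imp_measurable_on_sets_lebesgue) (use assms in \<open>auto intro!: continuous_intros\<close>)
  show "(\<lambda>z. exp (- z) / t) integrable_on {t..}"
    using integrable_on_exp_minus_to_infinity[of 1 t] integrable_on_divide by fastforce
  show "norm (exp (- z) / z) \<le> exp (- z) / t" if "z \<in> {t..}" for z
    using that assms by (auto simp: divide_simps)
qed auto

lemma E1_has_derivative:
  fixes t :: real assumes "t > 0"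
  shows "(exp_integral_E1 has_real_derivative - (exp (- t) / t)) (at t)"
proof -
  define a where "a = t / 2"
  define h where "h = (\<lambda>z::real. exp (- z) / z)"
  have a: "0 < a" "a < t" using assms by (auto simp: a_def)
  have split: "exp_integral_E1 s = exp_integral_E1 a - integral {a..s} h" if "s \<ge> a" for s
  proof -
    have "h integrable_on {a..s}"
      unfolding h_def using a by (intro integrable_continuous_real continuous_intros) auto
    then have "(h has_integral (integral {a..s} h + integral {s..} h)) ({a..s} \<union> {s..})"
      using E1_integrable[of s] a that unfolding h_def
      by (intro has_integral_Un integrable_integral) (auto simp: Int_atLeastAtMost ivl_disj_int)
    moreover have "{a..s} \<union> {s..} = {a..}" using that by auto
    ultimately show ?thesis
      unfolding exp_integral_E1_def h_def[symmetric] by (simp add: integral_unique)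
  qed
  have "((\<lambda>s. integral {a..s} h) has_real_derivative h t) (at t within {a..t+1})"
    unfolding h_def using a by (intro integral_has_real_derivative continuous_intros) auto
  then have "((\<lambda>s. integral {a..s} h) has_real_derivative h t) (at t)"
    using a at_within_Icc_at[of a t "t+1"] by simp
  then have "((\<lambda>s. exp_integral_E1 a - integral {a..s} h) has_real_derivative - h t) (at t)"
    by (auto intro!: derivative_eq_intros)
  then have "(exp_integral_E1 has_real_derivative - h t) (at t)"
    by (rule has_field_derivative_transform_within_open[where S="{a<..}"]) (use a in \<open>auto simp: split[symmetric]\<close>)
  then show ?thesis by (simp add: h_def)
qed

section \<open>Scalar recursions with a quadratic perturbation\<close>

definition log_contraction :: "real \<Rightarrow> real \<Rightarrow> real \<Rightarrow> real" where
  "log_contraction \<rho> c x = - ln (\<rho> + c * x)"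

text \<open>
  Up to an additive constant, the number of steps that the recursion \<open>x \<mapsto> x (\<rho> + c x)\<close> still needs
  from \<open>x\<close> to reach a fixed small level, estimated from above.
\<close>
definition step_clock :: "real \<Rightarrow> real \<Rightarrow> real \<Rightarrow> real" where
  "step_clock \<rho> c x = ln x / ln (1 / \<rho>)
     + exp_integral_E1 (log_contraction \<rho> c x) / (\<rho> * ln (1 / \<rho>))
     - ln (log_contraction \<rho> c x) / (2 * \<rho>)"

lemma step_clock_derivative:
  fixes \<rho> c x :: real
  assumes "0 < \<rho>" "\<rho> < 1" "0 \<le> c" "\<rho> + c < 1" "0 < x" "x \<le> 1"
  defines "f \<equiv> log_contraction \<rho> c x"
  shows "(step_clock \<rho> c has_real_derivative
           1 / (x * ln (1 / \<rho>)) + c / (\<rho> * ln (1 / \<rho>) * f) + c / (2 * \<rho> * (\<rho> + c * x) * f)) (at x)"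
    and "0 < f"
proof -
  have g: "0 < \<rho> + c * x" "\<rho> + c * x < 1"
    using assms mult_left_le[of x c] by (auto intro: add_pos_nonneg)
  then show f: "0 < f" by (simp add: f_def log_contraction_def)
  have ex: "exp (- f) = \<rho> + c * x" using g by (simp add: f_def log_contraction_def)
  have df: "(log_contraction \<rho> c has_real_derivative - (c / (\<rho> + c * x))) (at x)"
    unfolding log_contraction_def using g by (auto intro!: derivative_eq_intros)
  have dE: "((\<lambda>x. exp_integral_E1 (log_contraction \<rho> c x)) has_real_derivative c / f) (at x)"
    using DERIV_chain2[OF E1_has_derivative[OF f, unfolded f_def] df] g f
    by (simp add: f_def[symmetric] ex)
  have dl: "((\<lambda>x. ln (log_contraction \<rho> c x)) has_real_derivative - (c / ((\<rho> + c * x) * f))) (at x)"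
    using DERIV_chain2[OF DERIV_ln[OF f, unfolded f_def] df] by (simp add: f_def field_simps)
  have L: "ln (1 / \<rho>) > 0" using assms by simp
  have regroup: "inverse y / l + k / h / (r * l) - - (k / (w * h)) / (2 * r)
      = 1 / (y * l) + k / (r * l * h) + k / (2 * r * w * h)" for y l k h r w :: real
    by (simp add: inverse_eq_divide mult_ac)
  have "(step_clock \<rho> c has_real_derivative
           inverse x / ln (1 / \<rho>) + c / f / (\<rho> * ln (1 / \<rho>)) - - (c / ((\<rho> + c * x) * f)) / (2 * \<rho>)) (at x)"
    unfolding step_clock_def
    by (intro DERIV_diff DERIV_add DERIV_cdivide DERIV_ln dE dl assms(5))
  then show "(step_clock \<rho> c has_real_derivative
           1 / (x * ln (1 / \<rho>)) + c / (\<rho> * ln (1 / \<rho>) * f) + c / (2 * \<rho> * (\<rho> + c * x) * f)) (at x)"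
    unfolding regroup .
qed

text \<open>The inequality of weighted arithmetic and geometric means for the numbers \<open>1\<close> and \<open>r\<close>.\<close>
lemma ln_weighted_mean:
  fixes \<theta> r :: real
  assumes "0 \<le> \<theta>" "\<theta> < 1" "0 < r" "r \<le> 1"
  shows "\<theta> * ln r \<le> ln ((1 - \<theta>) + \<theta> * r)"
proof -
  have "(1 - \<theta>) * ln 1 + \<theta> * ln r \<le> ln ((1 - \<theta>) *\<^sub>R 1 + \<theta> *\<^sub>R r)"
    using assms by (intro concave_onD[OF ln_concave]) auto
  then show ?thesis by simp
qed

text \<open>
  The comparison function \<open>\<psi>\<close> decreases by exactly \<open>1\<close> over the step from \<open>y\<close> to \<open>z = y g(y)\<close>, and its
  derivative is at most that of the clock in between. Its first two terms integrate the tangent at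
  \<open>ln y\<close> of the convex function \<open>s \<mapsto> 1 / f(exp s)\<close>; the quadratic loss \<open>c y / (2 g(y))\<close> that the
  tangent incurs is paid for by the linear term \<open>N x\<close>, which is what the term
  \<open>- ln f / (2 \<rho>)\<close> of the clock provides.
\<close>
lemma step_clock_decrease:
  fixes \<rho> c y :: real
  assumes \<rho>: "0 < \<rho>" "\<rho> < 1" and c: "0 \<le> c" "\<rho> + c < 1" and y: "0 < y" "y \<le> 1"
  shows "step_clock \<rho> c (y * (\<rho> + c * y)) \<le> step_clock \<rho> c y - 1"
proof -
  define g where "g = (\<lambda>x. \<rho> + c * x)"
  define f where "f = log_contraction \<rho> c"
  define L where "L = ln (1 / \<rho>)"
  define M where "M = c * y / (g y * (f y)\<^sup>2)"
  define N where "N = c / (2 * g y * (1 - g y))"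
  define \<psi> where "\<psi> = (\<lambda>x. ln x / f y + M / 2 * (ln y - ln x)\<^sup>2 + N * x)"
  define z where "z = y * g y"
  have f_ln: "f x = - ln (g x)" for x by (simp add: f_def g_def log_contraction_def)
  have g: "\<rho> \<le> g x" "0 < g x" "g x < 1" "0 < f x" if "0 < x" "x \<le> 1" for x
  proof -
    show 1: "\<rho> \<le> g x" using c that by (simp add: g_def)
    then show 2: "0 < g x" using \<rho> by simp
    show 3: "g x < 1" using c that mult_left_le[of x c] by (simp add: g_def)
    show "0 < f x" using 2 3 by (simp add: f_ln)
  qed
  note gy = g[OF y]
  have L: "L > 0" using \<rho> by (simp add: L_def)
  have L_ln: "L = - ln \<rho>" using \<rho> by (simp add: L_def ln_div)
  have z: "0 < z" "z \<le> y" using y gy by (auto simp: z_def mult_left_le)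
  have "\<psi> y - step_clock \<rho> c y \<le> \<psi> z - step_clock \<rho> c z"
  proof (rule DERIV_nonpos_imp_nonincreasing[OF z(2), rule_format])
    fix x assume "z \<le> x" "x \<le> y"
    then have x: "0 < x" "x \<le> 1" using z y by auto
    note gx = g[OF x]
    have gxy: "g x \<le> g y" using \<open>x \<le> y\<close> c by (simp add: g_def mult_left_mono)
    then have fxy: "f y \<le> f x" using gx gy by (simp add: f_ln)
    let ?S = "1 / (x * L) + c / (\<rho> * L * f x) + c / (2 * \<rho> * g x * f x)"
    let ?P = "1 / (x * f y) - M * (ln y - ln x) / x + N"
    have "(\<psi> has_real_derivative ?P) (at x)"
      unfolding \<psi>_def using x gy
      by (auto intro!: derivative_eq_intros simp: field_simps)
    moreover have "(step_clock \<rho> c has_real_derivative ?S) (at x)"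
      using step_clock_derivative(1)[OF \<rho> c x] by (simp add: L_def f_def g_def)
    ultimately have "((\<lambda>x. \<psi> x - step_clock \<rho> c x) has_real_derivative ?P - ?S) (at x)"
      by (rule DERIV_diff)
    moreover have "?P - ?S \<le> 0"
    proof -
      \<comment> \<open>the first two terms of the clock dominate the integrand of the continuous descent time\<close>
      have "L - f x = ln (g x / \<rho>)" using gx \<rho> by (simp add: L_ln f_ln ln_div)
      also have "\<dots> \<le> g x / \<rho> - 1" using gx \<rho> by (intro ln_le_minus_one) auto
      also have "\<dots> = c * x / \<rho>" using \<rho> by (simp add: g_def field_simps)
      finally have a: "L - f x \<le> c * x / \<rho>" .
      have "1 / (x * f x) - 1 / (x * L) = (L - f x) / (x * L * f x)"
        using x L gx by (simp add: field_simps)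
      also have "\<dots> \<le> (c * x / \<rho>) / (x * L * f x)"
        using a x L gx by (intro divide_right_mono) auto
      also have "\<dots> = c / (\<rho> * L * f x)" using x by (simp add: field_simps)
      finally have 1: "1 / (x * f x) \<le> 1 / (x * L) + c / (\<rho> * L * f x)" by simp
      \<comment> \<open>the tangent bound; \<open>\<theta>\<close> is the weight for which \<open>g x / g y\<close> is a mean of \<open>1\<close> and \<open>x / y\<close>\<close>
      define \<theta> where "\<theta> = c * y / g y"
      have \<theta>: "0 \<le> \<theta>" "\<theta> < 1" using c y gy \<rho> by (auto simp: \<theta>_def g_def field_simps)
      have "\<theta> * ln (x / y) \<le> ln ((1 - \<theta>) + \<theta> * (x / y))"
        using \<theta> x y \<open>x \<le> y\<close> by (intro ln_weighted_mean) auto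
      also have "(1 - \<theta>) + \<theta> * (x / y) = g x / g y"
        using gy y by (simp add: \<theta>_def field_simps) (simp add: g_def algebra_simps)
      finally have b: "f x - f y \<le> \<theta> * (ln y - ln x)"
        using x y gx gy by (simp add: f_ln ln_div algebra_simps)
      have "1 / f y - 1 / f x = (f x - f y) / (f x * f y)"
        using gx gy by (simp add: field_simps)
      also have "\<dots> \<le> (f x - f y) / (f y * f y)"
        using fxy gy by (intro divide_left_mono mult_right_mono) auto
      also have "\<dots> \<le> (\<theta> * (ln y - ln x)) / (f y * f y)"
        using b gy by (intro divide_right_mono) auto
      also have "\<dots> = M * (ln y - ln x)"
        by (simp add: M_def \<theta>_def power2_eq_square)
      finally have "(1 / f y - M * (ln y - ln x)) / x \<le> (1 / f x) / x"
        using x by (intro divide_right_mono) auto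
      then have 2: "1 / (x * f y) - M * (ln y - ln x) / x \<le> 1 / (x * f x)"
        by (simp add: diff_divide_distrib mult.commute)
      \<comment> \<open>the factor \<open>1 / \<rho>\<close> in the clock absorbs the variation of \<open>g f\<close> over one step\<close>
      have gz: "g z \<le> g x" using \<open>z \<le> x\<close> c by (simp add: g_def mult_left_mono)
      have "f x = ln (1 / g x)" using gx by (simp add: f_ln ln_div)
      also have "\<dots> \<le> 1 / g x - 1" using gx by (intro ln_le_minus_one) auto
      finally have "g x * f x \<le> 1 - g x" using gx by (simp add: field_simps)
      also have "\<dots> \<le> 1 - g z" using gz by simp
      also have "\<dots> = (1 - g y) * (1 + g y - \<rho>)" by (simp add: g_def z_def algebra_simps)
      also have "\<dots> \<le> (1 - g y) * (g y / \<rho>)"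
      proof (rule mult_left_mono)
        have "0 \<le> (g y - \<rho>) * (1 - \<rho>)" using gy \<rho> by simp
        then show "1 + g y - \<rho> \<le> g y / \<rho>" using \<rho> by (simp add: field_simps)
      qed (use gy in simp)
      finally have "\<rho> * (g x * f x) \<le> g y * (1 - g y)" using \<rho> by (simp add: field_simps)
      then have "c / (2 * (g y * (1 - g y))) \<le> c / (2 * (\<rho> * (g x * f x)))"
        using c gx gy \<rho> by (intro divide_left_mono) auto
      then show ?thesis using 1 2 by (simp add: N_def mult.assoc)
    qed
    ultimately show "\<exists>D. ((\<lambda>x. \<psi> x - step_clock \<rho> c x) has_real_derivative D) (at x) \<and> D \<le> 0"
      by (intro exI conjI)
  qed
  moreover have "\<psi> y - \<psi> z = 1"
  proof -
    have "ln z = ln y - f y" using y gy by (simp add: z_def ln_mult f_ln)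
    then have "\<psi> y - \<psi> z = (ln y / f y - (ln y - f y) / f y) - M / 2 * (f y)\<^sup>2
        + N * (y - z)"
      by (simp add: \<psi>_def right_diff_distrib)
    also have "y - z = y * (1 - g y)" by (simp add: z_def algebra_simps)
    also have "N * (y * (1 - g y)) = c * y / (2 * g y)" using gy by (simp add: N_def)
    also have "M / 2 * (f y)\<^sup>2 = c * y / (2 * g y)" using gy by (simp add: M_def)
    also have "ln y / f y - (ln y - f y) / f y = 1" using gy by (simp add: field_simps)
    finally show ?thesis by simp
  qed
  ultimately show ?thesis unfolding z_def g_def by linarith
qed

lemma step_clock_mono:
  fixes \<rho> c x y :: real
  assumes "0 < \<rho>" "\<rho> < 1" "0 \<le> c" "\<rho> + c < 1" "0 < x" "x \<le> y" "y \<le> 1"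
  shows "step_clock \<rho> c x \<le> step_clock \<rho> c y"
proof (rule DERIV_nonneg_imp_nondecreasing[OF assms(6), rule_format])
  fix u assume "x \<le> u" "u \<le> y"
  then have u: "0 < u" "u \<le> 1" using assms by auto
  have "0 \<le> 1 / (u * ln (1 / \<rho>)) + c / (\<rho> * ln (1 / \<rho>) * log_contraction \<rho> c u)
        + c / (2 * \<rho> * (\<rho> + c * u) * log_contraction \<rho> c u)"
    using assms u step_clock_derivative(2)[OF assms(1-4) u]
    by (intro add_nonneg_nonneg divide_nonneg_nonneg mult_nonneg_nonneg) auto
  then show "\<exists>D. (step_clock \<rho> c has_real_derivative D) (at u) \<and> 0 \<le> D"
    using step_clock_derivative(1)[OF assms(1-4) u] by (intro exI conjI)
qed

lemma E1_antimono:
  fixes s t :: real assumes "0 < s" "s \<le> t"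
  shows "exp_integral_E1 t \<le> exp_integral_E1 s"
proof (rule DERIV_nonpos_imp_nonincreasing[OF assms(2), rule_format])
  fix u assume "s \<le> u" "u \<le> t"
  then have u: "u > 0" using assms by simp
  then have "- (exp (- u) / u) \<le> 0" by simp
  with E1_has_derivative[OF u] show "\<exists>D. (exp_integral_E1 has_real_derivative D) (at u) \<and> D \<le> 0"
    by (intro exI conjI)
qed

text \<open>
  If \<open>d k\<close> exceeded \<open>\<epsilon>\<close>, the clock would have lost at least \<open>k\<close> since the start; but its total
  range between \<open>1\<close> and \<open>d k\<close> is less than \<open>ln (1 / \<epsilon>) / ln (1 / \<rho>) + c3 - 1\<close>, since the correction terms at
  \<open>d k\<close> are controlled by their limits at \<open>0\<close>.
\<close>
lemma normalized_recursion_bound: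
  fixes d :: "nat \<Rightarrow> real" and \<rho> \<tau> \<epsilon> :: real
  assumes \<rho>: "0 < \<rho>" "\<rho> < 1" and \<tau>: "0 \<le> \<tau>" "\<tau> < 1"
    and d0: "d 0 = 1" and nonneg: "\<And>k. 0 \<le> d k"
    and step: "\<And>k. d k \<le> 1 \<Longrightarrow> d (Suc k) \<le> d k * (\<rho> + \<tau> * (1 - \<rho>) * d k)"
    and \<epsilon>: "0 < \<epsilon>" and k: "real k \<ge> ln (1 / \<epsilon>) / ln (1 / \<rho>) + c3 \<rho> \<tau>"
  shows "d k \<le> \<epsilon>"
proof (rule ccontr)
  assume "\<not> d k \<le> \<epsilon>"
  then have dk: "\<epsilon> < d k" by simp
  define c where "c = \<tau> * (1 - \<rho>)"
  have "0 < (1 - \<tau>) * (1 - \<rho>)" using \<rho> \<tau> by simp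
  then have c: "0 \<le> c" "\<rho> + c < 1" using \<rho> \<tau> by (simp_all add: c_def algebra_simps mult_left_le_one_le)
  have clock: "d j \<le> 1 \<and> (0 < d j \<longrightarrow> step_clock \<rho> c (d j) \<le> step_clock \<rho> c 1 - real j)" for j
  proof (induction j)
    case 0
    then show ?case by (simp add: d0)
  next
    case (Suc j)
    have le: "d (Suc j) \<le> d j * (\<rho> + c * d j)" using step Suc by (simp add: c_def)
    have "c * d j \<le> c" using Suc c by (intro mult_left_le) auto
    then have "d j * (\<rho> + c * d j) \<le> 1 * 1" using Suc c \<rho> nonneg[of j] by (intro mult_mono) auto
    then have le1: "d j * (\<rho> + c * d j) \<le> 1" by simp
    \<comment> \<open>the clock is only meaningful at positive arguments, and \<open>d j = 0\<close> would force \<open>d (Suc j) = 0\<close>\<close>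
    have "step_clock \<rho> c (d (Suc j)) \<le> step_clock \<rho> c 1 - real (Suc j)" if pos: "0 < d (Suc j)"
    proof -
      have "d j \<noteq> 0" using le pos by auto
      then have dj: "0 < d j" using nonneg[of j] by simp
      have "step_clock \<rho> c (d (Suc j)) \<le> step_clock \<rho> c (d j * (\<rho> + c * d j))"
        using step_clock_mono[OF \<rho> c pos le le1] .
      also have "\<dots> \<le> step_clock \<rho> c (d j) - 1"
        using step_clock_decrease[OF \<rho> c dj] Suc by simp
      finally show ?thesis using Suc dj by simp
    qed
    then show ?case using le le1 by simp
  qed
  have d: "0 < d k" "d k \<le> 1" using dk \<epsilon> clock[of k] by auto
  define L where "L = ln (1 / \<rho>)"
  define F where "F = log_contraction \<rho> c"
  have L: "L > 0" using \<rho> by (simp add: L_def)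
  have F1: "F 1 = ln (1 / (\<rho> + c))" "F 1 > 0"
    using c \<rho> by (simp_all add: F_def log_contraction_def ln_div)
  have Fd: "0 < F (d k)" using step_clock_derivative(2)[OF \<rho> c d] by (simp add: F_def)
  have "\<rho> \<le> \<rho> + c * d k" using c d by simp
  then have "ln \<rho> \<le> ln (\<rho> + c * d k)" using \<rho> by (subst ln_le_cancel_iff) auto
  then have FL: "F (d k) \<le> L" using \<rho> by (simp add: F_def L_def log_contraction_def ln_div)
  have "real k \<le> step_clock \<rho> c 1 - step_clock \<rho> c (d k)" using clock[of k] d by simp
  also have "\<dots> = - ln (d k) / L + (exp_integral_E1 (F 1) - exp_integral_E1 (F (d k))) / (\<rho> * L)
       + (ln (F (d k)) - ln (F 1)) / (2 * \<rho>)"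
    by (simp add: step_clock_def L_def F_def diff_divide_distrib)
  also have "\<dots> \<le> - ln (d k) / L + (exp_integral_E1 (F 1) - exp_integral_E1 L) / (\<rho> * L)
       + (ln L - ln (F 1)) / (2 * \<rho>)"
    using E1_antimono[OF Fd FL] FL Fd L \<rho>
    by (intro add_mono divide_right_mono diff_mono) auto
  also have "\<dots> = - ln (d k) / L + (c3 \<rho> \<tau> - 1)"
    using F1 L by (simp add: c3_def L_def[symmetric] c_def[symmetric] ln_div[of L])
  also have "- ln (d k) / L < ln (1 / \<epsilon>) / L"
    using dk \<epsilon> d L by (intro divide_strict_right_mono) (auto simp: ln_div)
  finally show False using k by (simp add: L_def)
qed

text \<open>
  Dividing by \<open>a 0\<close> normalises the sequence. The recursion is needed only as long as the sequence
  stays below its start, which it then does by itself; this is what makes the local estimate of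
  one descent step sufficient.
\<close>
lemma quadratic_recursion_bound:
  fixes a :: "nat \<Rightarrow> real" and \<rho> q \<epsilon> :: real
  assumes \<rho>: "0 < \<rho>" "\<rho> < 1" and q: "0 \<le> q" "q * a 0 < 1 - \<rho>"
    and nonneg: "\<And>k. 0 \<le> a k"
    and step: "\<And>k. a k \<le> a 0 \<Longrightarrow> a (Suc k) \<le> \<rho> * a k + q * (a k)\<^sup>2"
    and \<epsilon>: "0 < \<epsilon>"
    and k: "real k \<ge> ln (1 / \<epsilon>) / ln (1 / \<rho>) + c3 \<rho> (q * a 0 / (1 - \<rho>))"
  shows "a k \<le> \<epsilon> * a 0"
proof (cases "a 0 = 0")
  case True
  have "a j = 0" for j
  proof (induction j)
    case (Suc j)
    then show ?case using step[of j] nonneg[of "Suc j"] True by simp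
  qed (rule True)
  then show ?thesis by simp
next
  case False
  then have a0: "0 < a 0" using nonneg[of 0] by simp
  have "a k / a 0 \<le> \<epsilon>"
  proof (rule normalized_recursion_bound[OF \<rho> _ _ _ _ _ \<epsilon> k, where d = "\<lambda>k. a k / a 0"])
    fix j assume "a j / a 0 \<le> 1"
    then have "a (Suc j) / a 0 \<le> (\<rho> * a j + q * (a j)\<^sup>2) / a 0"
      using a0 step[of j] by (intro divide_right_mono) auto
    also have "\<dots> = a j / a 0 * (\<rho> + q * a 0 / (1 - \<rho>) * (1 - \<rho>) * (a j / a 0))"
      using a0 \<rho> by (simp add: field_simps power2_eq_square)
    finally show "a (Suc j) / a 0 \<le> a j / a 0 * (\<rho> + q * a 0 / (1 - \<rho>) * (1 - \<rho>) * (a j / a 0))" .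
  qed (use a0 q \<rho> nonneg in auto)
  then show ?thesis using a0 by (simp add: field_simps)
qed

section \<open>Norms and eigenvalues of symmetric matrices\<close>

lemma inner_transpose_matrix:
  fixes A :: "real ^ 'n ^ 'm"
  shows "(transpose A *v x) \<bullet> y = x \<bullet> (A *v y)"
  by (simp add: dot_lmul_matrix)

lemma inner_symmetric_matrix:
  fixes S :: "real ^ 'n ^ 'n"
  assumes "transpose S = S"
  shows "(S *v x) \<bullet> y = x \<bullet> (S *v y)"
  using inner_transpose_matrix[of S x y] assms by simp

text \<open>Eigenvectors to distinct eigenvalues are orthogonal, hence independent.\<close>
lemma finite_eigenvalues_symmetric:
  fixes M :: "real ^ 'n ^ 'n"
  assumes sym: "transpose M = M"
  shows "finite (eigenvalues M)"
proof -
  define e where "e = (\<lambda>l. SOME v. v \<noteq> 0 \<and> M *v v = l *\<^sub>R v)"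
  have e: "e l \<noteq> 0" "M *v e l = l *\<^sub>R e l" if "l \<in> eigenvalues M" for l
    using someI_ex[of "\<lambda>v. v \<noteq> 0 \<and> M *v v = l *\<^sub>R v"] that
    by (auto simp: e_def eigenvalues_def)
  have orth: "e l \<bullet> e m = 0" if "l \<in> eigenvalues M" "m \<in> eigenvalues M" "l \<noteq> m" for l m
    using inner_symmetric_matrix[OF sym, of "e l" "e m"] e[OF that(1)] e[OF that(2)] that(3)
    by simp
  have "inj_on e (eigenvalues M)"
  proof (rule inj_onI, rule ccontr)
    fix l m assume "l \<in> eigenvalues M" "m \<in> eigenvalues M" "e l = e m" "l \<noteq> m"
    then show False using orth[of l m] e(1)[of m] by simp
  qed
  moreover have "independent (e ` eigenvalues M)"
  proof (rule pairwise_orthogonal_independent)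
    show "pairwise orthogonal (e ` eigenvalues M)"
      unfolding pairwise_def orthogonal_def using orth by blast
    show "0 \<notin> e ` eigenvalues M" using e(1) by force
  qed
  ultimately show ?thesis
    using independent_bound finite_imageD by blast
qed

text \<open>
  Let \<open>u\<close> be a unit vector where the norm \<open>\<sigma>\<close> of \<open>S\<close> is attained. By symmetry the squared norm of
  \<open>S\<^sup>2 u - \<sigma>\<^sup>2 u\<close> expands to at most \<open>0\<close>, so \<open>(S - \<sigma>) (S + \<sigma>) u = 0\<close> and one of \<open>\<sigma>\<close>, \<open>- \<sigma>\<close> is an
  eigenvalue.
\<close>
lemma symmetric_matrix_norm_attained:
  fixes S :: "real ^ 'n ^ 'n"
  assumes sym: "transpose S = S"
  obtains \<mu> where "\<mu> \<in> eigenvalues S" "\<And>v. norm (S *v v) \<le> \<bar>\<mu>\<bar> * norm v"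
proof -
  have "\<exists>u\<in>sphere 0 1. \<forall>v\<in>sphere 0 1. norm (S *v v) \<le> norm (S *v u)"
    by (rule continuous_attains_sup)
       (auto intro: continuous_on_norm[OF linear_continuous_on[OF matrix_vector_mul_bounded_linear]])
  then obtain u where u: "norm u = 1" and max: "\<And>v. norm v = 1 \<Longrightarrow> norm (S *v v) \<le> norm (S *v u)"
    by auto
  define \<sigma> where "\<sigma> = norm (S *v u)"
  have bound: "norm (S *v v) \<le> \<sigma> * norm v" for v
  proof (cases "v = 0")
    case False
    then have "norm (S *v (v /\<^sub>R norm v)) \<le> \<sigma>" unfolding \<sigma>_def by (intro max) simp
    then show ?thesis using False
      by (simp add: matrix_vector_mult_scaleR field_simps)
  qed simp
  have "(norm (S *v (S *v u) - \<sigma>\<^sup>2 *\<^sub>R u))\<^sup>2 = (norm (S *v (S *v u)))\<^sup>2 - \<sigma>\<^sup>2 * \<sigma>\<^sup>2"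
  proof -
    have "(S *v (S *v u)) \<bullet> u = \<sigma>\<^sup>2"
      using inner_symmetric_matrix[OF sym, of "S *v u" u] by (simp add: \<sigma>_def power2_norm_eq_inner)
    then show ?thesis
      using u by (simp add: power2_norm_eq_inner inner_diff inner_commute)
        (simp add: power2_norm_eq_inner[symmetric] power2_eq_square)
  qed
  also have "\<dots> \<le> 0"
  proof -
    have "norm (S *v (S *v u)) \<le> \<sigma> * \<sigma>" using bound[of "S *v u"] by (simp add: \<sigma>_def)
    then have "(norm (S *v (S *v u)))\<^sup>2 \<le> (\<sigma> * \<sigma>)\<^sup>2" by (intro power_mono) auto
    then show ?thesis by (simp add: power2_eq_square)
  qed
  finally have sq: "S *v (S *v u) = \<sigma>\<^sup>2 *\<^sub>R u" by simp
  define w where "w = S *v u + \<sigma> *\<^sub>R u"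
  have w: "S *v w = \<sigma> *\<^sub>R w"
    by (simp add: w_def matrix_vector_right_distrib sq power2_eq_square scaleR_add_right
        matrix_vector_mult_scaleR add.commute)
  have "\<exists>\<mu>\<in>eigenvalues S. \<bar>\<mu>\<bar> = \<sigma>"
  proof (cases "w = 0")
    case True
    then have "S *v u = (- \<sigma>) *\<^sub>R u" by (simp add: w_def eq_neg_iff_add_eq_0)
    then have "- \<sigma> \<in> eigenvalues S" using u by (auto simp: eigenvalues_def intro!: exI[of _ u])
    then show ?thesis by (force simp: \<sigma>_def)
  next
    case False
    then have "\<sigma> \<in> eigenvalues S" using w by (auto simp: eigenvalues_def intro!: exI[of _ w])
    then show ?thesis by (force simp: \<sigma>_def)
  qed
  then show ?thesis using that bound by metis
qed

text \<open>
  The norm of \<open>I - \<eta> M\<close> is the modulus of one of its eigenvalues \<open>1 - \<eta> l\<close>, and \<open>l\<close> lies between the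
  extreme eigenvalues of \<open>M\<close>. The second claim carries the existence of an eigenvalue.
\<close>
lemma symmetric_gradient_step_norm:
  fixes M :: "real ^ 'n ^ 'n"
  assumes sym: "transpose M = M" and \<eta>: "0 < \<eta>"
  shows "norm (v - \<eta> *\<^sub>R (M *v v))
     \<le> max \<bar>1 - \<eta> * Max (eigenvalues M)\<bar> \<bar>1 - \<eta> * Min (eigenvalues M)\<bar> * norm v"
    and "Min (eigenvalues M) \<le> Max (eigenvalues M)"
proof -
  define S where "S = mat 1 - \<eta> *\<^sub>R M"
  have S: "S *v x = x - \<eta> *\<^sub>R (M *v x)" for x
    by (simp add: S_def matrix_vector_mult_diff_rdistrib scaleR_matrix_vector_assoc)
  have "transpose S = S"
    using sym by (simp add: S_def transpose_def vec_eq_iff mat_def)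
  then obtain \<mu> where \<mu>: "\<mu> \<in> eigenvalues S" and bound: "norm (S *v v) \<le> \<bar>\<mu>\<bar> * norm v"
    using symmetric_matrix_norm_attained by metis
  obtain x where x: "x \<noteq> 0" "x - \<eta> *\<^sub>R (M *v x) = \<mu> *\<^sub>R x"
    using \<mu> by (auto simp: eigenvalues_def S)
  define l where "l = (1 - \<mu>) / \<eta>"
  have "\<eta> *\<^sub>R (M *v x) = (1 - \<mu>) *\<^sub>R x" using x(2) by (simp add: algebra_simps)
  then have "(1 / \<eta>) *\<^sub>R \<eta> *\<^sub>R (M *v x) = (1 / \<eta>) *\<^sub>R (1 - \<mu>) *\<^sub>R x" by simp
  then have "M *v x = l *\<^sub>R x" using \<eta> by (simp add: l_def)
  then have "l \<in> eigenvalues M" using x(1) by (auto simp: eigenvalues_def)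
  then have l: "Min (eigenvalues M) \<le> l" "l \<le> Max (eigenvalues M)"
    using finite_eigenvalues_symmetric[OF sym] by auto
  then show "Min (eigenvalues M) \<le> Max (eigenvalues M)" by simp
  have "\<eta> * Min (eigenvalues M) \<le> \<eta> * l" "\<eta> * l \<le> \<eta> * Max (eigenvalues M)"
    using l \<eta> by auto
  moreover have "\<mu> = 1 - \<eta> * l" using \<eta> by (simp add: l_def)
  ultimately have "\<bar>\<mu>\<bar> \<le> max \<bar>1 - \<eta> * Max (eigenvalues M)\<bar> \<bar>1 - \<eta> * Min (eigenvalues M)\<bar>"
    by linarith
  then have "\<bar>\<mu>\<bar> * norm v
      \<le> max \<bar>1 - \<eta> * Max (eigenvalues M)\<bar> \<bar>1 - \<eta> * Min (eigenvalues M)\<bar> * norm v"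
    by (intro mult_right_mono) auto
  then show "norm (v - \<eta> *\<^sub>R (M *v v))
     \<le> max \<bar>1 - \<eta> * Max (eigenvalues M)\<bar> \<bar>1 - \<eta> * Min (eigenvalues M)\<bar> * norm v"
    using bound by (simp add: S)
qed

section \<open>Projection onto the sphere\<close>

lemma sphere_proj_scaleR:
  assumes "0 < r"
  shows "sphere_proj (r *\<^sub>R x) = sphere_proj x"
  using assms by (auto simp: sphere_proj_def field_simps)

lemma norm_sphere_proj: "norm (sphere_proj x) = 1"
  by (simp add: sphere_proj_def first_basis_vector_def)

text \<open>
  With \<open>s\<close> the projection, \<open>N\<close> the norm of \<open>u + w\<close> and \<open>a = u \<bullet> w\<close>, the remainder is
  \<open>a (u - s) + (1 + a - N) s\<close>. Both summands are of second order: \<open>u - s\<close> is of the size of \<open>w\<close>, and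
  \<open>N\<^sup>2 - (1 + a)\<^sup>2\<close> is the squared length of the tangential part of \<open>w\<close>.
\<close>
lemma sphere_proj_first_order:
  fixes u w :: "real ^ 'n::{finite,linorder}"
  assumes u: "norm u = 1" and w: "norm w \<le> 1 / 2"
  shows "norm (sphere_proj (u + w) - u - (w - (u \<bullet> w) *\<^sub>R u)) \<le> 2 * (norm w)\<^sup>2"
proof -
  define a where "a = u \<bullet> w"
  define N where "N = norm (u + w)"
  define s where "s = sphere_proj (u + w)"
  have a: "\<bar>a\<bar> \<le> norm w" using Cauchy_Schwarz_ineq2[of u w] u by (simp add: a_def)
  have N: "1 / 2 \<le> N" "\<bar>N - 1\<bar> \<le> norm w"
    using norm_triangle_ineq4[of "u + w" w] norm_triangle_ineq[of u w] u w by (auto simp: N_def)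
  have us: "N *\<^sub>R s = u + w" using N by (auto simp: s_def sphere_proj_def N_def)
  have s1: "norm s = 1" by (simp add: s_def norm_sphere_proj)
  have "norm (u - s) \<le> 2 * norm w"
  proof -
    have "u - s = (N - 1) *\<^sub>R s - w" using us by (simp add: algebra_simps)
    then have "norm (u - s) \<le> norm ((N - 1) *\<^sub>R s) + norm w" by (metis norm_triangle_ineq4)
    then show ?thesis using N(2) s1 by simp
  qed
  then have 1: "norm (a *\<^sub>R (u - s)) \<le> \<bar>a\<bar> * (2 * norm w)"
    by (simp add: mult_left_mono)
  have N2: "N\<^sup>2 = 1 + 2 * a + (norm w)\<^sup>2"
    using u by (simp add: N_def a_def power2_norm_eq_inner inner_add inner_commute)
       (simp add: power2_norm_eq_inner[symmetric])
  have "(N - (1 + a)) * (N + (1 + a)) = (norm w)\<^sup>2 - a\<^sup>2"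
    using N2 by (simp add: power2_eq_square algebra_simps)
  moreover have "1 + a \<le> N"
  proof (rule power2_le_imp_le)
    have "a\<^sup>2 \<le> (norm w)\<^sup>2" using power_mono[OF a, of 2] by simp
    then show "(1 + a)\<^sup>2 \<le> N\<^sup>2" using N2 by (simp add: power2_eq_square algebra_simps)
  qed (use N in simp)
  then have "(N - (1 + a)) * 1 \<le> (N - (1 + a)) * (N + (1 + a))"
    using N(1) a w by (intro mult_left_mono) auto
  ultimately have 2: "norm ((1 + a - N) *\<^sub>R s) \<le> (norm w)\<^sup>2 - a\<^sup>2"
    using \<open>1 + a \<le> N\<close> s1 by simp
  have "s - u - (w - a *\<^sub>R u) = a *\<^sub>R (u - s) + (1 + a - N) *\<^sub>R s"
    using us by (simp add: algebra_simps)
  then have "norm (s - u - (w - a *\<^sub>R u)) \<le> \<bar>a\<bar> * (2 * norm w) + ((norm w)\<^sup>2 - a\<^sup>2)"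
    using norm_triangle_ineq[of "a *\<^sub>R (u - s)" "(1 + a - N) *\<^sub>R s"] 1 2 by simp
  also have "\<dots> \<le> 2 * (norm w)\<^sup>2"
    using zero_le_power2[of "norm w - \<bar>a\<bar>"] by (simp add: power2_eq_square algebra_simps)
  finally show ?thesis by (simp add: s_def a_def)
qed

section \<open>Projected gradient descent\<close>

text \<open>
  Write \<open>P\<close> for the tangential projection \<open>U U\<^sup>T\<close> at \<open>xs\<close>, \<open>d\<close> for the error and \<open>G = I - \<eta> A\<^sup>T A\<close>. The
  first order term \<open>P w\<close> splits along \<open>d = P d + (xs \<bullet> d) xs\<close>: the tangential part contracts by \<open>\<kappa>\<close>
  and the normal part has size \<open>(norm d)\<^sup>2 / 2\<close>, which gives the summand linear in \<open>t\<close>. The summand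
  \<open>2 t\<^sup>2\<close> is the remainder of the projection; the assumption on \<open>t * norm (x - xs)\<close> keeps \<open>xs + w\<close>
  away from the origin.
\<close>
lemma pgd_step_error:
  fixes A :: "real ^ 'n::{finite,linorder} ^ 'm::finite" and U :: "real ^ 'k::finite ^ 'n::{finite,linorder}"
  assumes xs: "norm xs = 1" and stationary: "ls_gradient A b xs = \<gamma> *\<^sub>R xs"
    and U: "orthonormal_columns U" "U ** transpose U = mat 1 - outer_prod xs xs"
    and s: "\<eta> * \<gamma> < 1"
    and \<kappa>: "0 \<le> \<kappa>"
      "\<And>v. norm (v - \<eta> *\<^sub>R (transpose (A ** U) ** (A ** U) *v v)) \<le> \<kappa> * norm v"
    and t: "t = spectral_norm (mat 1 - \<eta> *\<^sub>R (transpose A ** A)) / (1 - \<eta> * \<gamma>)"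
    and x: "norm x = 1" "t * norm (x - xs) \<le> 1 / 2"
  shows "norm (pgd_step A b \<eta> x - xs)
     \<le> \<kappa> / (1 - \<eta> * \<gamma>) * norm (x - xs) + 2 * (t\<^sup>2 + t) * (norm (x - xs))\<^sup>2"
proof -
  define r where "r = 1 - \<eta> * \<gamma>"
  define G where "G = mat 1 - \<eta> *\<^sub>R (transpose A ** A)"
  define d where "d = x - xs"
  define w where "w = (1 / r) *\<^sub>R (G *v d)"
  define P where "P = (\<lambda>y. y - (xs \<bullet> y) *\<^sub>R xs)"
  have r: "0 < r" using s by (simp add: r_def)
  have G: "G *v y = y - \<eta> *\<^sub>R (transpose A *v (A *v y))" for y
    by (simp only: G_def matrix_vector_mult_diff_rdistrib scaleR_matrix_vector_assoc[symmetric]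
        matrix_vector_mul_assoc matrix_vector_mul_lid)
  have G_norm: "norm (G *v y) \<le> t * r * norm y" for y
    using onorm[OF matrix_vector_mul_bounded_linear, of G y] r
    by (simp add: t spectral_norm_def G_def r_def)
  have t0: "0 \<le> t"
    using onorm_pos_le[OF matrix_vector_mul_bounded_linear, of G] r
    by (simp add: t spectral_norm_def G_def r_def)

  have "ls_gradient A b x = ls_gradient A b xs + transpose A *v (A *v d)"
    unfolding ls_gradient_def d_def matrix_vector_right_distrib[symmetric]
    by (simp only: matrix_vector_mult_diff_distrib) (simp add: algebra_simps)
  then have grad: "ls_gradient A b x = \<gamma> *\<^sub>R xs + transpose A *v (A *v d)"
    by (simp only: stationary)
  have "x - \<eta> *\<^sub>R ls_gradient A b x = r *\<^sub>R xs + G *v d"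
    unfolding grad G by (simp add: r_def d_def algebra_simps)
  also have "\<dots> = r *\<^sub>R (xs + w)" using r by (simp add: w_def scaleR_add_right)
  finally have step: "pgd_step A b \<eta> x = sphere_proj (xs + w)"
    using r by (simp add: pgd_step_def sphere_proj_scaleR)

  have UU: "U *v (transpose U *v y) = P y" for y
  proof -
    have "outer_prod xs xs *v y = (xs \<bullet> y) *\<^sub>R xs"
      by (simp add: outer_prod_def matrix_vector_mult_def vec_eq_iff inner_vec_def
          sum_distrib_left sum_distrib_right mult_ac)
    then show ?thesis
      by (simp only: matrix_vector_mul_assoc U(2) P_def matrix_vector_mult_diff_rdistrib
          matrix_vector_mul_lid)
  qed
  have UtU: "transpose U *v (U *v z) = z" for z
  proof -
    have "transpose U ** U = mat 1"
      using U(1) by (simp add: matrix_mult_transpose_dot_column orthonormal_columns_def mat_def vec_eq_iff)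
    then show ?thesis by (simp only: matrix_vector_mul_assoc matrix_vector_mul_lid)
  qed
  have U_norm: "norm (U *v z) = norm z" for z
    using inner_transpose_matrix[of U "U *v z" z] by (simp only: UtU norm_eq_sqrt_inner)
  have P_norm: "norm (P y) \<le> norm y" for y
  proof (rule power2_le_imp_le)
    show "(norm (P y))\<^sup>2 \<le> (norm y)\<^sup>2"
      using xs by (simp add: P_def power2_norm_eq_inner inner_diff inner_commute norm_eq_1)
  qed simp
  have Ut_norm: "norm (transpose U *v y) \<le> norm y" for y
    using U_norm[of "transpose U *v y"] P_norm[of y] by (simp only: UU)

  have P_add: "P (y + c *\<^sub>R z) = P y + c *\<^sub>R P z" for y z c
    by (simp add: P_def algebra_simps inner_add_right)
  have PG: "norm (P (G *v P d)) \<le> \<kappa> * norm d"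
  proof -
    define z where "z = transpose U *v d"
    have "transpose U *v (G *v (U *v z))
        = z - \<eta> *\<^sub>R (transpose (A ** U) ** (A ** U) *v z)"
      unfolding G matrix_vector_mult_diff_distrib UtU
      by (simp only: matrix_vector_mult_scaleR matrix_transpose_mul matrix_vector_mul_assoc
          matrix_mul_assoc)
    then have "norm (P (G *v P d)) = norm (z - \<eta> *\<^sub>R (transpose (A ** U) ** (A ** U) *v z))"
      by (simp only: UU[symmetric] U_norm z_def)
    also have "\<dots> \<le> \<kappa> * norm z" by (rule \<kappa>)
    also have "\<dots> \<le> \<kappa> * norm d" using Ut_norm \<kappa>(1) unfolding z_def by (intro mult_left_mono)
    finally show ?thesis .
  qed
  have "xs \<bullet> d = - (norm d)\<^sup>2 / 2"
    using x(1) xs by (simp add: d_def power2_norm_eq_inner inner_diff inner_commute norm_eq_1)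
  then have "d = P d + (- (norm d)\<^sup>2 / 2) *\<^sub>R xs" by (simp add: P_def)
  then have "G *v d = G *v P d + (- (norm d)\<^sup>2 / 2) *\<^sub>R (G *v xs)"
    by (metis matrix_vector_right_distrib matrix_vector_mult_scaleR)
  then have "norm (P (G *v d)) \<le> norm (P (G *v P d)) + (norm d)\<^sup>2 / 2 * norm (P (G *v xs))"
    using norm_triangle_ineq[of "P (G *v P d)" "(- (norm d)\<^sup>2 / 2) *\<^sub>R P (G *v xs)"]
    by (simp only: P_add) simp
  also have "\<dots> \<le> \<kappa> * norm d + (norm d)\<^sup>2 / 2 * (t * r)"
    using PG order_trans[OF P_norm G_norm, of xs] xs by (intro add_mono mult_left_mono) auto
  finally have "norm (P (G *v d)) / r \<le> (\<kappa> * norm d + (norm d)\<^sup>2 / 2 * (t * r)) / r"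
    using r by (intro divide_right_mono) auto
  moreover have "norm (P w) = norm (P (G *v d)) / r"
    using P_add[of 0 "1 / r" "G *v d"] r by (simp add: w_def P_def)
  ultimately have Pw: "norm (P w) \<le> \<kappa> / r * norm d + t / 2 * (norm d)\<^sup>2"
    using r by (simp add: add_divide_distrib mult.commute)
  have w: "norm w \<le> t * norm d"
    using G_norm[of d] r by (simp add: w_def field_simps)
  have "norm (sphere_proj (xs + w) - xs - P w) \<le> 2 * (norm w)\<^sup>2"
    unfolding P_def using xs w x(2) by (intro sphere_proj_first_order) (auto simp: d_def)
  also have "\<dots> \<le> 2 * (t * norm d)\<^sup>2" using w by (intro mult_left_mono power_mono) auto
  finally have "norm (pgd_step A b \<eta> x - xs) \<le> 2 * (t * norm d)\<^sup>2 + norm (P w)"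
    using norm_triangle_ineq[of "sphere_proj (xs + w) - xs - P w" "P w"] by (simp add: step)
  also have "\<dots> \<le> \<kappa> / r * norm d + (2 * t\<^sup>2 + t / 2) * (norm d)\<^sup>2"
    using Pw by (simp add: power_mult_distrib algebra_simps)
  also have "\<dots> \<le> \<kappa> / r * norm d + 2 * (t\<^sup>2 + t) * (norm d)\<^sup>2"
    using t0 by (intro add_left_mono mult_right_mono) auto
  finally show ?thesis by (simp add: r_def d_def)
qed

theorem mainTheorem9:
  fixes A :: "real ^ 'n::{finite,linorder} ^ 'm::finite"
    and b :: "real ^ 'm"
    and xs :: "real ^ 'n::{finite,linorder}"
    and U :: "real ^ 'k::finite ^ 'n::{finite,linorder}"
    and \<gamma> \<eta> l_max l_min \<rho> t :: real
  assumes "CARD('n) \<ge> 2"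
    and "CARD('k) = CARD('n) - 1"
    and "xs \<in> unit_sphere"
    and "\<gamma> = xs \<bullet> (transpose A *v (A *v xs - b))"
    and "transpose A *v (A *v xs - b) = \<gamma> *\<^sub>R xs"
    and "orthonormal_columns U"
    and "U ** transpose U = mat 1 - outer_prod xs xs"
    and "l_max = Max (eigenvalues (transpose (A ** U) ** (A ** U)))"
    and "l_min = Min (eigenvalues (transpose (A ** U) ** (A ** U)))"
    and "\<eta> > 0"
    and "\<gamma> < l_min"
    and "\<eta> * (\<gamma> + l_max) < 2"
    and "\<rho> = 1 / (1 - \<eta> * \<gamma>) * max \<bar>1 - \<eta> * l_max\<bar> \<bar>1 - \<eta> * l_min\<bar>"
    and "t = spectral_norm (mat 1 - \<eta> *\<^sub>R (transpose A ** A)) / (1 - \<eta> * \<gamma>)"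
  shows "\<rho> < 1 \<and>
    locally_converges_at_rate A b \<eta> xs \<rho> t (convergence_region xs \<rho> t)"
proof -
  define M where "M = transpose (A ** U) ** (A ** U)"
  define \<kappa> where "\<kappa> = max \<bar>1 - \<eta> * l_max\<bar> \<bar>1 - \<eta> * l_min\<bar>"
  define q where "q = 2 * (t\<^sup>2 + t)"
  have xs: "norm xs = 1" using assms(3) by (simp add: unit_sphere_def)
  have stationary: "ls_gradient A b xs = \<gamma> *\<^sub>R xs" unfolding ls_gradient_def by (rule assms(5))
  have sym: "transpose M = M" unfolding M_def matrix_transpose_mul transpose_transpose ..
  have "l_min \<le> l_max"
    using symmetric_gradient_step_norm(2)[OF sym assms(10)] assms(8,9) by (simp only: M_def)
  then have order: "\<eta> * \<gamma> < \<eta> * l_min" "\<eta> * l_min \<le> \<eta> * l_max" "\<eta> * \<gamma> + \<eta> * l_max < 2"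
    using assms(10-12) by (auto simp: algebra_simps)
  then have s: "\<eta> * \<gamma> < 1" by linarith
  have \<kappa>: "0 \<le> \<kappa>" "\<kappa> < 1 - \<eta> * \<gamma>" using order unfolding \<kappa>_def by linarith+
  have \<rho>: "\<rho> = \<kappa> / (1 - \<eta> * \<gamma>)" using assms(13) by (simp add: \<kappa>_def)
  have \<rho>1: "\<rho> < 1" using \<kappa> s by (simp add: \<rho>)
  have \<kappa>M: "norm (v - \<eta> *\<^sub>R (transpose (A ** U) ** (A ** U) *v v)) \<le> \<kappa> * norm v" for v
    using symmetric_gradient_step_norm(1)[OF sym assms(10), of v]
    unfolding \<kappa>_def assms(8,9) M_def .
  have t: "0 \<le> t"
    using onorm_pos_le[OF matrix_vector_mul_bounded_linear,
        of "mat 1 - \<eta> *\<^sub>R (transpose A ** A)"] s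
    by (simp add: assms(14) spectral_norm_def)
  have q: "0 \<le> q" using t by (simp add: q_def)
  have "xs - \<eta> *\<^sub>R ls_gradient A b xs = (1 - \<eta> * \<gamma>) *\<^sub>R xs"
    by (simp add: stationary algebra_simps)
  moreover have "sphere_proj xs = xs" using xs by (auto simp: sphere_proj_def)
  ultimately have fixed: "xs = sphere_proj (xs - \<eta> *\<^sub>R ls_gradient A b xs)"
    using s by (simp add: sphere_proj_scaleR)
  have "norm (pgd A b \<eta> x0 k - xs) \<le> \<epsilon> * norm (x0 - xs)"
    if x0: "x0 \<in> unit_sphere" "x0 \<in> convergence_region xs \<rho> t" and "\<rho> > 0" and "0 < \<epsilon>"
      and k: "real k \<ge> ln (1 / \<epsilon>) / ln (1 / \<rho>) + c3 \<rho> (q * norm (x0 - xs) / (1 - \<rho>))"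
    for x0 \<epsilon> k
  proof -
    define a where "a = (\<lambda>k. norm (pgd A b \<eta> x0 k - xs))"
    have a0: "a 0 = norm (x0 - xs)" by (simp add: a_def pgd_def)
    have Suc: "pgd A b \<eta> x0 (Suc j) = pgd_step A b \<eta> (pgd A b \<eta> x0 j)" for j
      by (simp add: pgd_def)
    have unit: "norm (pgd A b \<eta> x0 j) = 1" for j
    proof (cases j)
      case 0
      then show ?thesis using x0 by (simp add: pgd_def unit_sphere_def)
    next
      case (Suc i)
      then show ?thesis by (simp add: pgd_def pgd_step_def norm_sphere_proj)
    qed
    \<comment> \<open>for \<open>q = 0\<close> the quotient that bounds the region is infinite and carries no information\<close>
    have qa0: "q * a 0 < 1 - \<rho>"
    proof (cases "q = 0")
      case False
      then have "0 < q" using q by simp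
      moreover have "ereal (norm (x0 - xs)) < ereal (1 - \<rho>) / ereal q"
        using x0(2) by (simp only: convergence_region_def q_def mem_Collect_eq)
      ultimately have "norm (x0 - xs) < (1 - \<rho>) / q" by simp
      then show ?thesis using \<open>0 < q\<close> by (simp add: a0 field_simps)
    qed (use \<rho>1 in simp)
    have "0 \<le> t\<^sup>2 * a 0" by (simp add: a_def)
    then have ta0: "t * a 0 \<le> 1 / 2" using qa0 \<open>\<rho> > 0\<close> by (simp add: q_def algebra_simps)
    have "a k \<le> \<epsilon> * a 0"
    proof (rule quadratic_recursion_bound[where a = a, OF \<open>\<rho> > 0\<close> \<rho>1 q qa0 _ _ \<open>0 < \<epsilon>\<close>])
      fix j assume "a j \<le> a 0"
      then have "t * a j \<le> t * a 0" using t by (intro mult_left_mono)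
      then have "t * norm (pgd A b \<eta> x0 j - xs) \<le> 1 / 2" using ta0 by (simp add: a_def)
      from pgd_step_error[OF xs stationary assms(6,7) s \<kappa>(1) \<kappa>M assms(14) unit this]
      show "a (Suc j) \<le> \<rho> * a j + q * (a j)\<^sup>2"
        by (simp only: a_def Suc \<rho> q_def)
    qed (use k a0 in \<open>auto simp: a_def\<close>)
    then show ?thesis by (simp add: a_def pgd_def)
  qed
  then show ?thesis
    using \<rho>1 fixed unfolding locally_converges_at_rate_def Let_def q_def by blast
qed

end
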